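(* Let $G$ be a finite abelian $p$-group with an action $\triangleleft$ of $C_p$ by automorphisms. If the action $\triangleleft$ is nontrivial, then $\mathcal{G}(\triangleleft)$ is a crossed product of $\mathbb{A}(\triangleleft)$ with $C(\triangleleft)$; that is, $\mathbb{A}(\triangleleft)$ is a normal subgroup of $\mathcal{G}(\triangleleft)$, $\mathcal{G}(\triangleleft)$ is the disjoint union of the cosets $\mathbb{A}(\triangleleft)\lambda_\alpha$, $\alpha\in C(\triangleleft)$, one has $\lambda_\alpha\lambda_\beta\in\mathbb{A}(\triangleleft)\lambda_{\alpha\beta}$ for all $\alpha,\beta\in C(\triangleleft)$, and $\phi\lambda_\alpha\mapsto\alpha$ is a surjective group homomorphism $\mathcal{G}(\triangleleft)\to C(\triangleleft)$ with kernel $\mathbb{A}(\triangleleft)$.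
   Context: $p$ is a prime, $C_p$ the cyclic group of order $p$, $A_p=\mathrm{Aut}(C_p)$. Actions of $C_p$ on $G$ are right actions by group automorphisms; automorphisms of $G$ are written on the right. For $\alpha\in A_p$ put $a\triangleleft^\alpha x=a\triangleleft\alpha(x)$. $I(\triangleleft,\triangleleft')$ is the set of $\lambda\in\mathrm{Aut}(G)$ with $(a\triangleleft x)\lambda=(a\lambda)\triangleleft' x$ for all $a\in G$, $x\in C_p$. $\mathbb{A}(\triangleleft)=I(\triangleleft,\triangleleft)$ is the group of $C_p$-linear automorphisms of $(G,\triangleleft)$. $C(\triangleleft)=\{\alpha\in A_p: I(\triangleleft,\triangleleft^\alpha)\ne\emptyset\}$, a subgroup of $A_p$. For each $\alpha\in C(\triangleleft)$ an element $\lambda_\alpha\in I(\triangleleft,\triangleleft^\alpha)$ is fixed, and $\mathcal{G}(\triangleleft)$ is the subgroup of $\mathrm{Aut}(G)$ generated by $\mathbb{A}(\triangleleft)$ and all $\lambda_\alpha$, $\alpha\in C(\triangleleft)$. *)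

theory Defs
  imports "HOL-Algebra.Algebra" "HOL-Library.Disjoint_Sets"
begin

(* Automorphisms are written on the right: the product f g means "first f, then g".
   This is the opposite of the multiplication of AutoGroup, which is composition. *)
definition right_AutoGroup :: "('a, 'm) monoid_scheme \<Rightarrow> ('a \<Rightarrow> 'a) monoid" where
  "right_AutoGroup G =
     (AutoGroup G) \<lparr>mult := \<lambda>f g. g \<otimes>\<^bsub>AutoGroup G\<^esub> f\<rparr>"

definition right_action_by_automorphisms ::
  "('a, 'm) monoid_scheme \<Rightarrow> ('c, 'n) monoid_scheme \<Rightarrow> ('a \<Rightarrow> 'c \<Rightarrow> 'a) \<Rightarrow> bool" where
  "right_action_by_automorphisms G C act \<longleftrightarrow>
     (\<forall>x\<in>carrier C. (\<lambda>a. act a x) \<in> iso G G) \<and>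
     (\<forall>a\<in>carrier G. act a \<one>\<^bsub>C\<^esub> = a) \<and>
     (\<forall>a\<in>carrier G. \<forall>x\<in>carrier C. \<forall>y\<in>carrier C. act (act a x) y = act a (x \<otimes>\<^bsub>C\<^esub> y))"

definition nontrivial_action ::
  "('a, 'm) monoid_scheme \<Rightarrow> ('c, 'n) monoid_scheme \<Rightarrow> ('a \<Rightarrow> 'c \<Rightarrow> 'a) \<Rightarrow> bool" where
  "nontrivial_action G C act \<longleftrightarrow> (\<exists>a\<in>carrier G. \<exists>x\<in>carrier C. act a x \<noteq> a)"

definition twist :: "('a \<Rightarrow> 'c \<Rightarrow> 'a) \<Rightarrow> ('c \<Rightarrow> 'c) \<Rightarrow> 'a \<Rightarrow> 'c \<Rightarrow> 'a" where
  "twist act \<alpha> = (\<lambda>a x. act a (\<alpha> x))"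

definition intertwiners ::
  "('a, 'm) monoid_scheme \<Rightarrow> ('c, 'n) monoid_scheme \<Rightarrow>
   ('a \<Rightarrow> 'c \<Rightarrow> 'a) \<Rightarrow> ('a \<Rightarrow> 'c \<Rightarrow> 'a) \<Rightarrow> ('a \<Rightarrow> 'a) set" where
  "intertwiners G C act act' =
     {f \<in> auto G. \<forall>a\<in>carrier G. \<forall>x\<in>carrier C. f (act a x) = act' (f a) x}"

definition linear_automorphisms ::
  "('a, 'm) monoid_scheme \<Rightarrow> ('c, 'n) monoid_scheme \<Rightarrow> ('a \<Rightarrow> 'c \<Rightarrow> 'a) \<Rightarrow> ('a \<Rightarrow> 'a) set" where
  "linear_automorphisms G C act = intertwiners G C act act"

definition twist_stabilizer ::
  "('a, 'm) monoid_scheme \<Rightarrow> ('c, 'n) monoid_scheme \<Rightarrow> ('a \<Rightarrow> 'c \<Rightarrow> 'a) \<Rightarrow> ('c \<Rightarrow> 'c) set" where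
  "twist_stabilizer G C act = {\<alpha> \<in> auto C. intertwiners G C act (twist act \<alpha>) \<noteq> {}}"

definition twist_stabilizer_group ::
  "('a, 'm) monoid_scheme \<Rightarrow> ('c, 'n) monoid_scheme \<Rightarrow> ('a \<Rightarrow> 'c \<Rightarrow> 'a) \<Rightarrow> ('c \<Rightarrow> 'c) monoid" where
  "twist_stabilizer_group G C act = (AutoGroup C) \<lparr>carrier := twist_stabilizer G C act\<rparr>"

definition extended_automorphism_group ::
  "('a, 'm) monoid_scheme \<Rightarrow> ('c, 'n) monoid_scheme \<Rightarrow> ('a \<Rightarrow> 'c \<Rightarrow> 'a) \<Rightarrow>
   (('c \<Rightarrow> 'c) \<Rightarrow> ('a \<Rightarrow> 'a)) \<Rightarrow> ('a \<Rightarrow> 'a) monoid" where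
  "extended_automorphism_group G C act lam =
     (right_AutoGroup G)
       \<lparr>carrier := generate (right_AutoGroup G)
          (linear_automorphisms G C act \<union> lam ` twist_stabilizer G C act)\<rparr>"

end

theory Submission
  imports Defs
begin

text \<open>
  A nontrivial action of a group of prime order is faithful, because its kernel is a proper
  subgroup. For a faithful action, an automorphism \<open>f\<close> of \<open>G\<close> intertwines \<open>\<triangleleft>\<close> with \<open>\<triangleleft>\<^sup>\<alpha>\<close>
  for at most one \<open>\<alpha>\<close>. The automorphisms admitting such an \<open>\<alpha>\<close> form a subgroup of
  \<open>Aut(G)\<close>, on which \<open>f \<mapsto> \<alpha>\<close> is multiplicative since \<open>Aut(C\<^sub>p)\<close> is abelian. Its kernel is
  \<open>\<A>(\<triangleleft>)\<close>, its image is \<open>C(\<triangleleft>)\<close>, and its fibre over \<open>\<alpha>\<close> is the coset of \<open>\<lambda>\<^sub>\<alpha>\<close>.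
\<close>

section \<open>Automorphism groups, under composition and under the opposite product\<close>

lemma carrier_AutoGroup [simp]: "carrier (AutoGroup G) = auto G"
  by (simp add: AutoGroup_def)

lemma one_AutoGroup: "\<one>\<^bsub>AutoGroup G\<^esub> = (\<lambda>x\<in>carrier G. x)"
  by (simp add: AutoGroup_def BijGroup_def)

lemma mult_AutoGroup_apply:
  "\<lbrakk>f \<in> auto G; g \<in> auto G; x \<in> carrier G\<rbrakk> \<Longrightarrow> (f \<otimes>\<^bsub>AutoGroup G\<^esub> g) x = f (g x)"
  by (simp add: AutoGroup_def BijGroup_def auto_def compose_def)

lemma auto_hom: "f \<in> auto G \<Longrightarrow> f \<in> hom G G"
  by (simp add: auto_def)

lemma auto_closed: "\<lbrakk>f \<in> auto G; x \<in> carrier G\<rbrakk> \<Longrightarrow> f x \<in> carrier G"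
  by (meson auto_hom hom_in_carrier)

text \<open>Members of \<open>auto G\<close> are extensional: outside the carrier all of them take
  the same default value, so agreement on the carrier suffices.\<close>

lemma auto_eqI:
  assumes "f \<in> auto G" "g \<in> auto G" and "\<And>x. x \<in> carrier G \<Longrightarrow> f x = g x"
  shows "f = g"
proof (rule extensionalityI)
  show "f \<in> extensional (carrier G)" "g \<in> extensional (carrier G)"
    using assms(1,2) by (simp_all add: auto_def Bij_imp_extensional)
qed (rule assms(3))

lemma carrier_right_AutoGroup [simp]: "carrier (right_AutoGroup G) = auto G"
  by (simp add: right_AutoGroup_def)

lemma one_right_AutoGroup [simp]: "\<one>\<^bsub>right_AutoGroup G\<^esub> = \<one>\<^bsub>AutoGroup G\<^esub>"
  by (simp add: right_AutoGroup_def)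

lemma mult_right_AutoGroup [simp]: "f \<otimes>\<^bsub>right_AutoGroup G\<^esub> g = g \<otimes>\<^bsub>AutoGroup G\<^esub> f"
  by (simp add: right_AutoGroup_def)

context group
begin

interpretation Aut: group "AutoGroup G"
  by (rule AutoGroup)

lemma auto_mult_closed: "\<lbrakk>f \<in> auto G; g \<in> auto G\<rbrakk> \<Longrightarrow> f \<otimes>\<^bsub>AutoGroup G\<^esub> g \<in> auto G"
  using Aut.m_closed by simp

lemma auto_inv_closed: "f \<in> auto G \<Longrightarrow> inv\<^bsub>AutoGroup G\<^esub> f \<in> auto G"
  using Aut.inv_closed by simp

lemma auto_inv_apply:
  assumes "f \<in> auto G" "x \<in> carrier G"
  shows "f ((inv\<^bsub>AutoGroup G\<^esub> f) x) = x" and "(inv\<^bsub>AutoGroup G\<^esub> f) (f x) = x"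
proof -
  note inv = auto_inv_closed[OF assms(1)]
  show "f ((inv\<^bsub>AutoGroup G\<^esub> f) x) = x"
    unfolding mult_AutoGroup_apply[OF assms(1) inv assms(2), symmetric]
    using assms by (simp add: one_AutoGroup)
  show "(inv\<^bsub>AutoGroup G\<^esub> f) (f x) = x"
    unfolding mult_AutoGroup_apply[OF inv assms, symmetric]
    using assms by (simp add: one_AutoGroup)
qed

lemma right_AutoGroup: "group (right_AutoGroup G)"
proof (rule groupI)
  fix f assume "f \<in> carrier (right_AutoGroup G)"
  then show "\<exists>g\<in>carrier (right_AutoGroup G). g \<otimes>\<^bsub>right_AutoGroup G\<^esub> f = \<one>\<^bsub>right_AutoGroup G\<^esub>"
    by (intro bexI[of _ "inv\<^bsub>AutoGroup G\<^esub> f"]) (simp_all add: auto_inv_closed)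
qed (use Aut.one_closed in \<open>simp_all add: auto_mult_closed Aut.m_assoc\<close>)

text \<open>Inverses are two-sided, so reversing the product does not change them. Inverses for
  either product can thus be computed in \<open>AutoGroup G\<close>.\<close>

lemma inv_right_AutoGroup:
  assumes "f \<in> auto G"
  shows "inv\<^bsub>right_AutoGroup G\<^esub> f = inv\<^bsub>AutoGroup G\<^esub> f"
  by (rule group.inv_equality[OF right_AutoGroup]) (simp_all add: assms auto_inv_closed)

text \<open>On a cyclic group an automorphism is determined by the image of a generator
  \<open>z\<close>. If \<open>f\<close> and \<open>g\<close> send \<open>z\<close> to its powers
  with exponents \<open>k\<close> and \<open>m\<close>, both composites raise every power of
  \<open>z\<close> to the exponent \<open>k * m\<close>.\<close>

lemma cyclic_auto_commute:
  assumes "cyclic_group G" and f: "f \<in> auto G" and g: "g \<in> auto G"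
  shows "f \<otimes>\<^bsub>AutoGroup G\<^esub> g = g \<otimes>\<^bsub>AutoGroup G\<^esub> f"
proof (rule auto_eqI[where G = G])
  obtain z where z: "z \<in> carrier G" and gen: "carrier G = range (\<lambda>n::int. z [^] n)"
    using assms(1) cyclic_group by blast
  obtain k m :: int where k: "f z = z [^] k" and m: "g z = z [^] m"
    using auto_closed[OF f z] auto_closed[OF g z] gen by auto
  have pow: "h (z [^] n) = h z [^] n" if "h \<in> auto G" for h and n :: int
    using hom_int_pow[OF auto_hom[OF that] z is_group is_group] .
  fix x assume x: "x \<in> carrier G"
  then obtain n :: int where n: "x = z [^] n"
    using gen by auto
  show "(f \<otimes>\<^bsub>AutoGroup G\<^esub> g) x = (g \<otimes>\<^bsub>AutoGroup G\<^esub> f) x"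
    using f g x z unfolding n
    by (simp add: mult_AutoGroup_apply pow k m int_pow_pow mult.commute mult.left_commute)
qed (simp_all add: f g auto_mult_closed)

end

section \<open>Automorphisms that are semilinear over a twist of the acting group\<close>

locale right_automorphism_action =
  G: group G + C: group C
  for G :: "('a, 'm) monoid_scheme" and C :: "('c, 'n) monoid_scheme" and act +
  assumes action: "right_action_by_automorphisms G C act"
begin

text \<open>These are the \<alpha>-semilinear automorphisms: moving \<open>f\<close> past the action
  applies \<alpha> to the acting element. \<open>I \<alpha>\<close> will be the fibre over \<alpha>
  of the homomorphism to be constructed.\<close>

abbreviation I where "I \<alpha> \<equiv> intertwiners G C act (twist act \<alpha>)"

lemma act_closed: "\<lbrakk>a \<in> carrier G; x \<in> carrier C\<rbrakk> \<Longrightarrow> act a x \<in> carrier G"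
  using action by (fastforce simp: right_action_by_automorphisms_def iso_def hom_def)

lemma act_one: "a \<in> carrier G \<Longrightarrow> act a \<one>\<^bsub>C\<^esub> = a"
  using action by (simp add: right_action_by_automorphisms_def)

lemma act_act:
  "\<lbrakk>a \<in> carrier G; x \<in> carrier C; y \<in> carrier C\<rbrakk> \<Longrightarrow> act (act a x) y = act a (x \<otimes>\<^bsub>C\<^esub> y)"
  using action by (simp add: right_action_by_automorphisms_def)

lemma intertwiner_auto: "f \<in> I \<alpha> \<Longrightarrow> f \<in> auto G"
  by (simp add: intertwiners_def)

lemma intertwiner_apply:
  "\<lbrakk>f \<in> I \<alpha>; a \<in> carrier G; x \<in> carrier C\<rbrakk> \<Longrightarrow> f (act a x) = act (f a) (\<alpha> x)"
  by (simp add: intertwiners_def twist_def)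

lemma intertwinerI:
  "\<lbrakk>f \<in> auto G; \<And>a x. \<lbrakk>a \<in> carrier G; x \<in> carrier C\<rbrakk> \<Longrightarrow> f (act a x) = act (f a) (\<alpha> x)\<rbrakk> \<Longrightarrow> f \<in> I \<alpha>"
  by (simp add: intertwiners_def twist_def)

text \<open>The identity of \<open>AutoGroup C\<close> fixes every element of
  \<open>carrier C\<close>, and intertwining is tested only there. The linear automorphisms thereby
  become the fibre over the identity twist.\<close>

lemma linear_automorphisms_eq: "linear_automorphisms G C act = I \<one>\<^bsub>AutoGroup C\<^esub>"
  by (auto simp: linear_automorphisms_def intertwiners_def twist_def one_AutoGroup)

text \<open>Moving first \<open>g\<close> and then \<open>f\<close> past the action applies first
  \<beta> and then \<alpha> to the acting element. With composition on both sides, the twists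
  multiply in the same order as the maps.\<close>

lemma intertwiner_mult:
  assumes "f \<in> I \<alpha>" "g \<in> I \<beta>" "\<alpha> \<in> auto C" "\<beta> \<in> auto C"
  shows "f \<otimes>\<^bsub>AutoGroup G\<^esub> g \<in> I (\<alpha> \<otimes>\<^bsub>AutoGroup C\<^esub> \<beta>)"
proof (rule intertwinerI)
  note f = intertwiner_auto[OF assms(1)] and g = intertwiner_auto[OF assms(2)]
  show "f \<otimes>\<^bsub>AutoGroup G\<^esub> g \<in> auto G"
    by (rule G.auto_mult_closed[OF f g])
  fix a x assume "a \<in> carrier G" "x \<in> carrier C"
  then show "(f \<otimes>\<^bsub>AutoGroup G\<^esub> g) (act a x)
      = act ((f \<otimes>\<^bsub>AutoGroup G\<^esub> g) a) ((\<alpha> \<otimes>\<^bsub>AutoGroup C\<^esub> \<beta>) x)"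
    using assms f g
    by (simp add: mult_AutoGroup_apply act_closed auto_closed
        intertwiner_apply[OF assms(1)] intertwiner_apply[OF assms(2)])
qed

text \<open>The map \<open>f\<close> sends \<open>act (?g a) (?\<beta> x)\<close> to
  \<open>act a x\<close>, since both inverses cancel; applying \<open>?g\<close> gives the
  claim.\<close>

lemma intertwiner_inv:
  assumes "f \<in> I \<alpha>" "\<alpha> \<in> auto C"
  shows "inv\<^bsub>AutoGroup G\<^esub> f \<in> I (inv\<^bsub>AutoGroup C\<^esub> \<alpha>)"
proof (rule intertwinerI)
  note f = intertwiner_auto[OF assms(1)]
  let ?g = "inv\<^bsub>AutoGroup G\<^esub> f" and ?\<beta> = "inv\<^bsub>AutoGroup C\<^esub> \<alpha>"
  show g: "?g \<in> auto G"
    by (rule G.auto_inv_closed[OF f])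
  fix a x assume a: "a \<in> carrier G" and x: "x \<in> carrier C"
  have \<beta>x: "?\<beta> x \<in> carrier C" and ga: "?g a \<in> carrier G"
    using C.auto_inv_closed[OF assms(2)] g a x by (simp_all add: auto_closed)
  have "f (act (?g a) (?\<beta> x)) = act a x"
    using intertwiner_apply[OF assms(1) ga \<beta>x] G.auto_inv_apply(1)[OF f a]
      C.auto_inv_apply(1)[OF assms(2) x] by simp
  then show "?g (act a x) = act (?g a) (?\<beta> x)"
    using G.auto_inv_apply(2)[OF f act_closed[OF ga \<beta>x]] by simp
qed

lemma twist_stabilizerI: "\<lbrakk>\<alpha> \<in> auto C; f \<in> I \<alpha>\<rbrakk> \<Longrightarrow> \<alpha> \<in> twist_stabilizer G C act"
  by (auto simp: twist_stabilizer_def)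

section \<open>The subgroups of twists and of semilinear automorphisms, and their cosets\<close>

lemma subgroup_twist_stabilizer: "subgroup (twist_stabilizer G C act) (AutoGroup C)"
proof (rule group.subgroupI[OF C.AutoGroup])
  have "\<one>\<^bsub>AutoGroup G\<^esub> \<in> I \<one>\<^bsub>AutoGroup C\<^esub>"
    by (rule intertwinerI) (auto simp: one_AutoGroup G.id_in_auto act_closed)
  then show "twist_stabilizer G C act \<noteq> {}"
    using twist_stabilizerI C.id_in_auto one_AutoGroup by (metis empty_iff)
  show "inv\<^bsub>AutoGroup C\<^esub> \<alpha> \<in> twist_stabilizer G C act" if "\<alpha> \<in> twist_stabilizer G C act" for \<alpha>
    using that twist_stabilizerI[OF C.auto_inv_closed intertwiner_inv]
    by (force simp: twist_stabilizer_def)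
  show "\<alpha> \<otimes>\<^bsub>AutoGroup C\<^esub> \<beta> \<in> twist_stabilizer G C act"
    if \<alpha>\<beta>: "\<alpha> \<in> twist_stabilizer G C act" "\<beta> \<in> twist_stabilizer G C act" for \<alpha> \<beta>
  proof -
    obtain f g where "f \<in> I \<alpha>" "g \<in> I \<beta>" "\<alpha> \<in> auto C" "\<beta> \<in> auto C"
      using \<alpha>\<beta> unfolding twist_stabilizer_def by blast
    then show ?thesis
      using twist_stabilizerI[OF C.auto_mult_closed intertwiner_mult] by blast
  qed
qed (simp add: twist_stabilizer_def)

lemma subgroup_semilinear:
  "subgroup (\<Union>\<alpha>\<in>twist_stabilizer G C act. I \<alpha>) (right_AutoGroup G)"
proof (rule group.subgroupI[OF G.right_AutoGroup])
  let ?S = "twist_stabilizer G C act"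
  have S: "\<alpha> \<in> auto C" if "\<alpha> \<in> ?S" for \<alpha>
    using that by (simp add: twist_stabilizer_def)
  interpret S: subgroup ?S "AutoGroup C"
    by (rule subgroup_twist_stabilizer)
  show "(\<Union>\<alpha>\<in>?S. I \<alpha>) \<subseteq> carrier (right_AutoGroup G)"
    using intertwiner_auto by auto
  \<comment> \<open>That the identity twist belongs to \<open>?S\<close> says precisely that its set
    of intertwiners is nonempty.\<close>
  show "(\<Union>\<alpha>\<in>?S. I \<alpha>) \<noteq> {}"
    using S.one_closed by (auto simp: twist_stabilizer_def)
  show "inv\<^bsub>right_AutoGroup G\<^esub> f \<in> (\<Union>\<alpha>\<in>?S. I \<alpha>)" if f: "f \<in> (\<Union>\<alpha>\<in>?S. I \<alpha>)" for f
  proof -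
    obtain \<alpha> where "\<alpha> \<in> ?S" "f \<in> I \<alpha>"
      using f by blast
    then show ?thesis
      using intertwiner_inv S S.m_inv_closed group.axioms C.AutoGroup
      by (auto simp: G.inv_right_AutoGroup intertwiner_auto)
  qed
  show "f \<otimes>\<^bsub>right_AutoGroup G\<^esub> g \<in> (\<Union>\<alpha>\<in>?S. I \<alpha>)"
    if fg: "f \<in> (\<Union>\<alpha>\<in>?S. I \<alpha>)" "g \<in> (\<Union>\<alpha>\<in>?S. I \<alpha>)" for f g
  proof -
    obtain \<alpha> \<beta> where "\<alpha> \<in> ?S" "f \<in> I \<alpha>" "\<beta> \<in> ?S" "g \<in> I \<beta>"
      using fg by blast
    then show ?thesis
      \<comment> \<open>The right-handed product is the composite of \<open>g\<close> after
        \<open>f\<close>, so it lies over \<beta>\<alpha>, which is again in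
        \<open>?S\<close>.\<close>
      using intertwiner_mult[of g \<beta> f \<alpha>] S S.m_closed[of \<beta> \<alpha>] by auto
  qed
qed

text \<open>Two automorphisms with the same twist differ by one with trivial twist, that is, by a
  linear one. A right coset for the right-handed product is a left coset for composition, which is
  why the linear factor is applied before \<open>g\<close>.\<close>

lemma intertwiners_eq_coset:
  assumes "\<alpha> \<in> auto C" "g \<in> I \<alpha>"
  shows "I \<alpha> = linear_automorphisms G C act #>\<^bsub>right_AutoGroup G\<^esub> g"
proof (intro equalityI subsetI)
  interpret AG: group "AutoGroup G" by (rule G.AutoGroup)
  interpret AC: group "AutoGroup C" by (rule C.AutoGroup)
  note g = intertwiner_auto[OF assms(2)]
  fix f assume f: "f \<in> I \<alpha>"
  \<comment> \<open>The linear factor is forced by the equation that \<open>f\<close> equals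
    \<open>g\<close> composed after \<open>h\<close>.\<close>
  define h where "h = inv\<^bsub>AutoGroup G\<^esub> g \<otimes>\<^bsub>AutoGroup G\<^esub> f"
  have "h \<in> I (inv\<^bsub>AutoGroup C\<^esub> \<alpha> \<otimes>\<^bsub>AutoGroup C\<^esub> \<alpha>)"
    unfolding h_def using assms f
    by (intro intertwiner_mult intertwiner_inv C.auto_inv_closed)
  then have "h \<in> linear_automorphisms G C act"
    using assms by (simp add: linear_automorphisms_eq)
  moreover have "f = h \<otimes>\<^bsub>right_AutoGroup G\<^esub> g"
    unfolding h_def using g intertwiner_auto[OF f] G.auto_inv_closed[OF g] AG.m_assoc[symmetric]
    by simp
  ultimately show "f \<in> linear_automorphisms G C act #>\<^bsub>right_AutoGroup G\<^esub> g"
    by (auto simp: r_coset_def)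
next
  interpret AC: group "AutoGroup C" by (rule C.AutoGroup)
  fix f assume "f \<in> linear_automorphisms G C act #>\<^bsub>right_AutoGroup G\<^esub> g"
  then obtain h where "h \<in> I \<one>\<^bsub>AutoGroup C\<^esub>" "f = g \<otimes>\<^bsub>AutoGroup G\<^esub> h"
    by (auto simp: r_coset_def linear_automorphisms_eq)
  then show "f \<in> I \<alpha>"
    using intertwiner_mult[OF assms(2) _ assms(1), of h "\<one>\<^bsub>AutoGroup C\<^esub>"] AC.one_closed AC.r_one assms(1)
    by simp
qed

text \<open>The union of the fibres is a subgroup containing the generators. It is the least one,
  because each fibre is the coset of \<open>lam \<alpha>\<close> and so consists of products of two
  generators.\<close>

lemma carrier_extended_automorphism_group:
  assumes lam: "\<forall>\<alpha>\<in>twist_stabilizer G C act. lam \<alpha> \<in> I \<alpha>"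
  shows "carrier (extended_automorphism_group G C act lam) = (\<Union>\<alpha>\<in>twist_stabilizer G C act. I \<alpha>)"
proof -
  let ?S = "twist_stabilizer G C act" and ?A = "linear_automorphisms G C act"
  interpret R: group "right_AutoGroup G"
    by (rule G.right_AutoGroup)
  have one: "\<one>\<^bsub>AutoGroup C\<^esub> \<in> ?S"
    using subgroup.one_closed[OF subgroup_twist_stabilizer] .
  have "(\<Union>\<alpha>\<in>?S. I \<alpha>) = generate (right_AutoGroup G) (?A \<union> lam ` ?S)"
  proof (rule R.generateI[OF subgroup_semilinear])
    show "?A \<union> lam ` ?S \<subseteq> (\<Union>\<alpha>\<in>?S. I \<alpha>)"
      using lam one by (auto simp: linear_automorphisms_eq)
    fix K assume K: "subgroup K (right_AutoGroup G)" "?A \<union> lam ` ?S \<subseteq> K"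
    show "(\<Union>\<alpha>\<in>?S. I \<alpha>) \<subseteq> K"
    proof
      fix f assume "f \<in> (\<Union>\<alpha>\<in>?S. I \<alpha>)"
      then obtain \<alpha> where \<alpha>: "\<alpha> \<in> ?S" "f \<in> I \<alpha>"
        by blast
      then have "f \<in> ?A #>\<^bsub>right_AutoGroup G\<^esub> lam \<alpha>"
        using intertwiners_eq_coset lam by (auto simp: twist_stabilizer_def)
      then obtain h where "h \<in> ?A" "f = h \<otimes>\<^bsub>right_AutoGroup G\<^esub> lam \<alpha>"
        unfolding r_coset_def by blast
      then show "f \<in> K"
        using subgroup.m_closed[OF K(1)] K(2) \<alpha>(1) by blast
    qed
  qed
  then show ?thesis
    by (simp add: extended_automorphism_group_def)
qed

section \<open>Faithfulness of the action and uniqueness of the twist\<close>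

lemma prime_order_faithful:
  assumes "Factorial_Ring.prime (order C)" and "nontrivial_action G C act"
    and x: "x \<in> carrier C" and y: "y \<in> carrier C"
    and eq: "\<And>a. a \<in> carrier G \<Longrightarrow> act a x = act a y"
  shows "x = y"
proof -
  \<comment> \<open>The kernel of the action. By Lagrange its order divides the prime
    \<open>order C\<close>, and by nontriviality it is smaller, so it is 1.\<close>
  define K where "K = {x \<in> carrier C. \<forall>a\<in>carrier G. act a x = a}"
  have "subgroup K C"
  proof (rule C.subgroupI)
    show "inv\<^bsub>C\<^esub> u \<in> K" if "u \<in> K" for u
    proof -
      have "act a (inv\<^bsub>C\<^esub> u) = a" if "a \<in> carrier G" for a
        using \<open>u \<in> K\<close> that act_act[of a u "inv\<^bsub>C\<^esub> u"] by (simp add: K_def act_one)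
      then show ?thesis
        using that by (simp add: K_def)
    qed
    show "u \<otimes>\<^bsub>C\<^esub> v \<in> K" if "u \<in> K" "v \<in> K" for u v
      using that by (simp add: K_def flip: act_act)
  qed (auto simp: K_def act_one)
  moreover have fin: "finite (carrier C)"
    using assms(1) C.order_gt_0_iff_finite by (simp add: prime_gt_0_nat)
  ultimately have "card K dvd order C"
    using C.lagrange[of K] by (metis dvd_triv_right)
  moreover have "K \<subset> carrier C"
    using assms(2) by (auto simp: K_def nontrivial_action_def)
  then have "card K < order C"
    using fin by (simp add: order_def psubset_card_mono)
  ultimately have "card K = 1"
    using assms(1) by (metis nat_neq_iff prime_nat_iff)
  moreover have "\<one>\<^bsub>C\<^esub> \<in> K"
    by (simp add: K_def act_one)
  ultimately have K: "K = {\<one>\<^bsub>C\<^esub>}"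
    by (metis card_1_singletonE singletonD)
  \<comment> \<open>Two elements that act alike have a quotient in the kernel, so a trivial kernel
    makes them equal.\<close>
  have "act a (x \<otimes>\<^bsub>C\<^esub> inv\<^bsub>C\<^esub> y) = a" if "a \<in> carrier G" for a
  proof -
    have "act a (x \<otimes>\<^bsub>C\<^esub> inv\<^bsub>C\<^esub> y) = act (act a y) (inv\<^bsub>C\<^esub> y)"
      using that x y by (simp add: eq flip: act_act)
    also have "\<dots> = a"
      using that y by (simp add: act_act act_one)
    finally show ?thesis .
  qed
  then have "x \<otimes>\<^bsub>C\<^esub> inv\<^bsub>C\<^esub> y \<in> K"
    using x y by (simp add: K_def)
  then have "x \<otimes>\<^bsub>C\<^esub> inv\<^bsub>C\<^esub> y = \<one>\<^bsub>C\<^esub>"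
    using K by simp
  then show "x = y"
    using x y by (metis C.inv_closed C.inv_equality C.inv_inv)
qed

text \<open>Since \<open>f\<close> is onto, every \<open>b\<close> has the form \<open>f a\<close>.
  Then \<open>f (act a x)\<close> equals both \<open>act b (\<alpha> x)\<close> and
  \<open>act b (\<beta> x)\<close>, and faithfulness gives equality of the two acting
  elements.\<close>

lemma intertwiner_twist_unique:
  assumes "Factorial_Ring.prime (order C)" and "nontrivial_action G C act"
    and "\<alpha> \<in> auto C" "\<beta> \<in> auto C" and f: "f \<in> I \<alpha>" "f \<in> I \<beta>"
  shows "\<alpha> = \<beta>"
proof (rule auto_eqI[OF assms(3,4)])
  fix x assume x: "x \<in> carrier C"
  have f': "f \<in> auto G"
    by (rule intertwiner_auto[OF f(1)])
  show "\<alpha> x = \<beta> x"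
  proof (rule prime_order_faithful[OF assms(1,2)])
    fix b assume b: "b \<in> carrier G"
    define a where "a = (inv\<^bsub>AutoGroup G\<^esub> f) b"
    have "a \<in> carrier G" "f a = b"
      using f' b by (simp_all add: a_def G.auto_inv_apply(1) G.auto_inv_closed auto_closed)
    then show "act b (\<alpha> x) = act b (\<beta> x)"
      using intertwiner_apply[OF f(1) _ x] intertwiner_apply[OF f(2) _ x] by metis
  qed (simp_all add: assms x auto_closed)
qed

end

section \<open>The crossed product structure, read off from the twist homomorphism\<close>

theorem proposition4p10:
  fixes p :: nat
    and G :: "('a, 'm) monoid_scheme"
    and C :: "('c, 'n) monoid_scheme"
    and act :: "'a \<Rightarrow> 'c \<Rightarrow> 'a"
    and lam :: "('c \<Rightarrow> 'c) \<Rightarrow> 'a \<Rightarrow> 'a"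
  defines "A \<equiv> linear_automorphisms G C act"
    and "S \<equiv> twist_stabilizer G C act"
    and "R \<equiv> right_AutoGroup G"
    and "\<G> \<equiv> extended_automorphism_group G C act lam"
    and "\<C> \<equiv> twist_stabilizer_group G C act"
  assumes "Factorial_Ring.prime p"
    and "group C" and "cyclic_group C" and "order C = p"
    and "comm_group G" and "finite (carrier G)" and "\<exists>n. order G = p ^ n"
    and "right_action_by_automorphisms G C act"
    and "nontrivial_action G C act"
    and "\<forall>\<alpha>\<in>S. lam \<alpha> \<in> intertwiners G C act (twist act \<alpha>)"
  shows "A \<lhd> \<G> \<and>
    carrier \<G> = (\<Union>\<alpha>\<in>S. A #>\<^bsub>R\<^esub> lam \<alpha>) \<and>
    disjoint_family_on (\<lambda>\<alpha>. A #>\<^bsub>R\<^esub> lam \<alpha>) S \<and>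
    (\<forall>\<alpha>\<in>S. \<forall>\<beta>\<in>S. lam \<alpha> \<otimes>\<^bsub>R\<^esub> lam \<beta> \<in> A #>\<^bsub>R\<^esub> lam (\<alpha> \<otimes>\<^bsub>AutoGroup C\<^esub> \<beta>)) \<and>
    (\<exists>\<pi>. (\<forall>\<phi>\<in>A. \<forall>\<alpha>\<in>S. \<pi> (\<phi> \<otimes>\<^bsub>R\<^esub> lam \<alpha>) = \<alpha>) \<and>
         group_hom \<G> \<C> \<pi> \<and>
         \<pi> ` carrier \<G> = carrier \<C> \<and>
         kernel \<G> \<C> \<pi> = A)"
proof -
  interpret right_automorphism_action G C act
    using assms by (simp add: right_automorphism_action_def right_automorphism_action_axioms_def
        comm_group.axioms)
  let ?AC = "AutoGroup C"
  have ord: "Factorial_Ring.prime (order C)"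
    using assms by simp
  have lam: "lam \<alpha> \<in> I \<alpha>" if "\<alpha> \<in> S" for \<alpha>
    using assms that by blast
  have S: "\<alpha> \<in> auto C" if "\<alpha> \<in> S" for \<alpha>
    using that by (simp add: S_def twist_stabilizer_def)
  have comm: "\<alpha> \<otimes>\<^bsub>?AC\<^esub> \<beta> = \<beta> \<otimes>\<^bsub>?AC\<^esub> \<alpha>" if "\<alpha> \<in> S" "\<beta> \<in> S" for \<alpha> \<beta>
    using C.cyclic_auto_commute \<open>cyclic_group C\<close> S that by blast
  interpret S: subgroup S ?AC
    unfolding S_def by (rule subgroup_twist_stabilizer)
  have coset: "A #>\<^bsub>R\<^esub> lam \<alpha> = I \<alpha>" if "\<alpha> \<in> S" for \<alpha>
    using intertwiners_eq_coset[OF S lam] that by (simp add: A_def R_def)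
  have carrier: "carrier \<G> = (\<Union>\<alpha>\<in>S. I \<alpha>)"
    unfolding \<G>_def S_def using lam by (intro carrier_extended_automorphism_group) (simp add: S_def)
  \<comment> \<open>Composition in reverse order gives the twist \<beta>\<alpha>; commutativity of
    the automorphisms of the cyclic group turns it into \<alpha>\<beta>.\<close>
  have mult: "f \<otimes>\<^bsub>R\<^esub> g \<in> I (\<alpha> \<otimes>\<^bsub>?AC\<^esub> \<beta>)"
    if "\<alpha> \<in> S" "\<beta> \<in> S" "f \<in> I \<alpha>" "g \<in> I \<beta>" for \<alpha> \<beta> f g
    using intertwiner_mult[of g \<beta> f \<alpha>] that S comm by (simp add: R_def)
  have unique: "\<alpha> = \<beta>" if "\<alpha> \<in> S" "\<beta> \<in> S" "f \<in> I \<alpha>" "f \<in> I \<beta>" for \<alpha> \<beta> f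
    using intertwiner_twist_unique[OF ord \<open>nontrivial_action G C act\<close>] S that by blast
  \<comment> \<open>The twist of \<open>f\<close>: it exists and is unique for \<open>f\<close> in
    \<open>carrier \<G>\<close>; elsewhere the value is unspecified.\<close>
  define \<pi> where "\<pi> f = (THE \<alpha>. \<alpha> \<in> S \<and> f \<in> I \<alpha>)" for f
  have \<pi>: "\<pi> f = \<alpha>" if "\<alpha> \<in> S" "f \<in> I \<alpha>" for f \<alpha>
    unfolding \<pi>_def using that unique by blast
  have mult_\<G>: "f \<otimes>\<^bsub>\<G>\<^esub> g = f \<otimes>\<^bsub>R\<^esub> g" for f g
    by (simp add: \<G>_def R_def extended_automorphism_group_def)
  have \<C>: "carrier \<C> = S" "f \<otimes>\<^bsub>\<C>\<^esub> g = f \<otimes>\<^bsub>?AC\<^esub> g" "\<one>\<^bsub>\<C>\<^esub> = \<one>\<^bsub>?AC\<^esub>" for f g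
    by (simp_all add: \<C>_def S_def twist_stabilizer_group_def)
  \<comment> \<open>With the generated carrier replaced by the explicit union, the group laws follow
    from \<open>subgroup_semilinear\<close>.\<close>
  have "\<G> = R\<lparr>carrier := \<Union>\<alpha>\<in>S. I \<alpha>\<rparr>"
    using carrier by (simp add: \<G>_def R_def extended_automorphism_group_def)
  then have "group \<G>"
    using subgroup.subgroup_is_group[OF subgroup_semilinear G.right_AutoGroup]
    by (simp add: R_def S_def)
  moreover have "group \<C>"
    unfolding \<C>_def twist_stabilizer_group_def
    using subgroup.subgroup_is_group[OF subgroup_twist_stabilizer C.AutoGroup] .
  moreover have "\<pi> \<in> hom \<G> \<C>"
  proof (rule homI)
    show "\<pi> f \<in> carrier \<C>" if "f \<in> carrier \<G>" for f
      using that \<pi> by (auto simp: carrier \<C>)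
    show "\<pi> (f \<otimes>\<^bsub>\<G>\<^esub> g) = \<pi> f \<otimes>\<^bsub>\<C>\<^esub> \<pi> g" if fg: "f \<in> carrier \<G>" "g \<in> carrier \<G>" for f g
    proof -
      obtain \<alpha> \<beta> where *: "\<alpha> \<in> S" "f \<in> I \<alpha>" "\<beta> \<in> S" "g \<in> I \<beta>"
        using fg unfolding carrier by blast
      show ?thesis
        using \<pi>[OF S.m_closed mult] \<pi> * by (simp add: mult_\<G> \<C>)
    qed
  qed
  ultimately have hom: "group_hom \<G> \<C> \<pi>"
    by (simp add: group_hom_def group_hom_axioms_def)
  \<comment> \<open>An element has trivial twist exactly if it lies in the fibre over the identity,
    which is \<open>A\<close>. Normality of \<open>A\<close> then comes from its being a
    kernel.\<close>
  have ker: "kernel \<G> \<C> \<pi> = A"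
    using \<pi> S.one_closed by (auto simp: kernel_def carrier \<C> A_def linear_automorphisms_eq)
  have "A \<lhd> \<G>"
    using group_hom.normal_kernel[OF hom] ker by simp
  moreover have "carrier \<G> = (\<Union>\<alpha>\<in>S. A #>\<^bsub>R\<^esub> lam \<alpha>)"
    by (simp add: carrier coset)
  \<comment> \<open>The cosets are the fibres, and a common element of two fibres would have two
    twists.\<close>
  moreover have "disjoint_family_on (\<lambda>\<alpha>. A #>\<^bsub>R\<^esub> lam \<alpha>) S"
    using unique by (auto simp: disjoint_family_on_def coset)
  moreover have "lam \<alpha> \<otimes>\<^bsub>R\<^esub> lam \<beta> \<in> A #>\<^bsub>R\<^esub> lam (\<alpha> \<otimes>\<^bsub>?AC\<^esub> \<beta>)"
    if "\<alpha> \<in> S" "\<beta> \<in> S" for \<alpha> \<beta>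
    using that mult lam coset[OF S.m_closed] by simp
  moreover have "\<pi> (\<phi> \<otimes>\<^bsub>R\<^esub> lam \<alpha>) = \<alpha>" if "\<phi> \<in> A" "\<alpha> \<in> S" for \<phi> \<alpha>
  proof (rule \<pi>)
    show "\<phi> \<otimes>\<^bsub>R\<^esub> lam \<alpha> \<in> I \<alpha>"
      using that by (auto simp: r_coset_def simp flip: coset)
  qed (use that in simp)
  \<comment> \<open>Each \<alpha> in \<open>S\<close> is attained at
    \<open>lam \<alpha>\<close>.\<close>
  moreover have "\<pi> ` carrier \<G> = carrier \<C>"
    using \<pi> lam by (force simp: carrier \<C> image_iff)
  ultimately show ?thesis
    using hom ker by blast
qed

end
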